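(* Let $(Y,g)$ be a chain transitive zero-dimensional system. Then there exist a densely uniformly chaotic zero-dimensional system $(X,f)$ containing $(Y,g)$ as a subsystem (that is, up to topological conjugacy, $Y$ is a closed subset of $X$ with $f(Y)=Y$ and $f|_Y=g$) and a dense uniformly chaotic invariant set $K\subset X\setminus Y$ such that: (1) the restriction $f|_{X\setminus Y}$ is a homeomorphism of $X\setminus Y$ onto itself; (2) $K=\bigcup_{N\ge 1}C_N$, where $C_1\subset C_2\subset\cdots$ is an increasing sequence of Cantor sets; (3) each $C_N$ is both positively and negatively uniformly proximal; (4) each $C_N$ is both positively and negatively uniformly recurrent; (5) $f(K)=K$; (6) $K$ is dense in $X$; (7) each $x\in K$ is both positively and negatively transitive.
   Context: A topological dynamical system is a pair $(X,f)$ with $X$ a compact metric space (metric $d$) and $f:X\to X$ a continuous surjection (not necessarily injective). It is called a zero-dimensional system if $X$ is totally disconnected. It is chain transitive if for every $\epsilon>0$ and every pair $(x,y)\in X\times X$ there is a finite sequence $(x_0=x,x_1,\dots,x_l=y)$ of points of $X$ with $d(f(x_i),x_{i+1})<\epsilon$ for all $0\le i<l$. A subset $A\subset X$ is (positively) uniformly recurrent if for every $\epsilon>0$ there exist arbitrarily large $n>0$ such that $d(f^n(x),x)<\epsilon$ for all $x\in A$. A subset $A\subset X$ is (positively) uniformly proximal if $\liminf_{n\to+\infty}\operatorname{diam}(f^n(A))=0$. For $A\subset X\setminus Y$, where $f$ restricts to a homeomorphism of $X\setminus Y$ onto itself, negatively uniformly recurrent and negatively uniformly proximal mean the same conditions with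 $f^n$ replaced by $f^{-n}$ ($n>0$), where $f^{-n}$ denotes the $n$-th iterate of the inverse of $f|_{X\setminus Y}$. A subset $K\subset X$ is a uniformly chaotic set if there exist Cantor sets $C_1\subset C_2\subset\cdots$ in $X$ such that $K=\bigcup_{i\ge1}C_i$ and, for each $N\ge 1$, $C_N$ is uniformly recurrent and uniformly proximal. The system $(X,f)$ is densely uniformly chaotic if it has a uniformly chaotic subset that is dense in $X$. A set $K$ is invariant if $f(K)=K$. A point $x\in X$ is positively transitive if $\{f^n(x): n\ge0\}$ is dense in $X$. A point $x\in X\setminus Y$ is negatively transitive if $\{f^{-n}(x): n\ge 0\}$ is dense in $X$, where $f^{-n}$ denotes the $n$-th iterate of the inverse of the homeomorphism $f|_{X\setminus Y}$ of $X\setminus Y$ onto itself (and $f^{0}$ is the identity). *)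

theory Defs
  imports "HOL-Analysis.Analysis"
begin

text \<open>
  A system is a carrier set together with a map that is total on the ambient type; only the
  values of the map on the carrier matter.  The empty system is not excluded.
\<close>

definition dynamical_system :: "'a::metric_space set \<Rightarrow> ('a \<Rightarrow> 'a) \<Rightarrow> bool" where
  "dynamical_system X f \<longleftrightarrow> compact X \<and> continuous_on X f \<and> f ` X = X"

definition totally_disconnected :: "'a::topological_space set \<Rightarrow> bool" where
  "totally_disconnected X \<longleftrightarrow> (\<forall>S. S \<subseteq> X \<and> connected S \<longrightarrow> (\<exists>a. S \<subseteq> {a}))"

definition zero_dimensional_system :: "'a::metric_space set \<Rightarrow> ('a \<Rightarrow> 'a) \<Rightarrow> bool" where
  "zero_dimensional_system X f \<longleftrightarrow> dynamical_system X f \<and> totally_disconnected X"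

definition chain_transitive :: "'a::metric_space set \<Rightarrow> ('a \<Rightarrow> 'a) \<Rightarrow> bool" where
  "chain_transitive X f \<longleftrightarrow>
     (\<forall>\<epsilon>>0. \<forall>x\<in>X. \<forall>y\<in>X. \<exists>(l::nat) u.
        u 0 = x \<and> u l = y \<and> (\<forall>i\<le>l. u i \<in> X) \<and> (\<forall>i<l. dist (f (u i)) (u (Suc i)) < \<epsilon>))"

definition uniformly_recurrent :: "('a::metric_space \<Rightarrow> 'a) \<Rightarrow> 'a set \<Rightarrow> bool" where
  "uniformly_recurrent f A \<longleftrightarrow>
     (\<forall>\<epsilon>>0. \<forall>m::nat. \<exists>n>m. \<forall>x\<in>A. dist ((f ^^ n) x) x < \<epsilon>)"

text \<open>
  The real-valued \<open>diameter\<close> is meaningful only for bounded sets; below, all iterated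
  images lie in a compact set.
\<close>

definition uniformly_proximal :: "('a::metric_space \<Rightarrow> 'a) \<Rightarrow> 'a set \<Rightarrow> bool" where
  "uniformly_proximal f A \<longleftrightarrow> liminf (\<lambda>n. ereal (diameter ((f ^^ n) ` A))) = 0"

definition cantor_set :: "'a::topological_space set \<Rightarrow> bool" where
  "cantor_set C \<longleftrightarrow> C homeomorphic (UNIV :: (nat \<Rightarrow> bool) set)"

definition uniformly_chaotic_set ::
    "'a::metric_space set \<Rightarrow> ('a \<Rightarrow> 'a) \<Rightarrow> 'a set \<Rightarrow> bool" where
  "uniformly_chaotic_set X f K \<longleftrightarrow>
     (\<exists>C :: nat \<Rightarrow> 'a set.
        (\<forall>N. cantor_set (C N) \<and> C N \<subseteq> X) \<and> incseq C \<and> K = (\<Union>N. C N) \<and>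
        (\<forall>N. uniformly_recurrent f (C N) \<and> uniformly_proximal f (C N)))"

definition dense_in :: "'a::topological_space set \<Rightarrow> 'a set \<Rightarrow> bool" where
  "dense_in X K \<longleftrightarrow> K \<subseteq> X \<and> X \<subseteq> closure K"

definition densely_uniformly_chaotic :: "'a::metric_space set \<Rightarrow> ('a \<Rightarrow> 'a) \<Rightarrow> bool" where
  "densely_uniformly_chaotic X f \<longleftrightarrow> (\<exists>K. uniformly_chaotic_set X f K \<and> dense_in X K)"

definition positively_transitive ::
    "'a::metric_space set \<Rightarrow> ('a \<Rightarrow> 'a) \<Rightarrow> 'a \<Rightarrow> bool" where
  "positively_transitive X f x \<longleftrightarrow> dense_in X (range (\<lambda>n. (f ^^ n) x))"

text \<open>
  In the negative notions the first argument \<open>S\<close> is a set that \<open>f\<close> maps homeomorphically onto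
  itself; there \<open>inv_into S f\<close> is the inverse of the restriction of \<open>f\<close> to \<open>S\<close>.  The notions
  are meant for points and subsets of \<open>S\<close>.
\<close>

definition negatively_uniformly_recurrent ::
    "'a::metric_space set \<Rightarrow> ('a \<Rightarrow> 'a) \<Rightarrow> 'a set \<Rightarrow> bool" where
  "negatively_uniformly_recurrent S f A \<longleftrightarrow> uniformly_recurrent (inv_into S f) A"

definition negatively_uniformly_proximal ::
    "'a::metric_space set \<Rightarrow> ('a \<Rightarrow> 'a) \<Rightarrow> 'a set \<Rightarrow> bool" where
  "negatively_uniformly_proximal S f A \<longleftrightarrow> uniformly_proximal (inv_into S f) A"

text \<open>Density of the backward orbit is required in the whole space \<open>X\<close>, not just in \<open>S\<close>.\<close>

definition negatively_transitive ::
    "'a::metric_space set \<Rightarrow> 'a set \<Rightarrow> ('a \<Rightarrow> 'a) \<Rightarrow> 'a \<Rightarrow> bool" where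
  "negatively_transitive S X f x \<longleftrightarrow> dense_in X (range (\<lambda>n. (inv_into S f ^^ n) x))"

definition topologically_conjugate ::
    "'a::metric_space set \<Rightarrow> ('a \<Rightarrow> 'a) \<Rightarrow> 'b::metric_space set \<Rightarrow> ('b \<Rightarrow> 'b) \<Rightarrow> bool" where
  "topologically_conjugate Y g Z f \<longleftrightarrow>
     (\<exists>h h'. homeomorphism Y Z h h' \<and> (\<forall>y\<in>Y. h (g y) = f (h y)))"

definition subsystem ::
    "'a::metric_space set \<Rightarrow> 'a set \<Rightarrow> ('a \<Rightarrow> 'a) \<Rightarrow> bool" where
  "subsystem Z X f \<longleftrightarrow> Z \<subseteq> X \<and> closed Z \<and> f ` Z = Z"

end

(* Encode Y in {0,1}^N; the two-sided orbits of g then form a closed shift-invariant set in the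
   full two-sided shift W over the Cantor alphabet {0,1}^N, namely the natural extension of (Y,g).
   Identifying two of its points when their forward halves agree turns it into (Y,g) and does not
   affect its complement in W; this quotient of W is X.

   In W a point is recurrent along n when a far block repeats its central block, and a set of
   points is proximal along n when all its points vanish on a common far block.  A Cantor set of
   points chaotic_point t is built by filling blocks around the positions +-4^(q+1), cyclically in q,
   with zeros, with a copy of the central block, with an entry of a list of all finite patterns, and
   with a marker carrying a digit of t.  Every shift of such a point is transitive in both time
   directions, the markers make the shifted Cantor sets pairwise disjoint, and K is their union. *)

theory Submission
  imports Defs
begin

subsection \<open>Cantor sets and totally disconnected compact sets\<close>

lemma compact_UNIV_fun:
  assumes "compact (UNIV :: 'b::topological_space set)"
  shows "compact (UNIV :: ('a \<Rightarrow> 'b) set)"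
proof -
  have "compact_space (product_topology (\<lambda>_::'a. euclidean :: 'b topology) UNIV)"
    using assms by (intro compact_space_product_topology[THEN iffD2]) (simp add: compact_space_def)
  then show ?thesis
    by (simp add: euclidean_product_topology compact_space_def)
qed

lemma compact_UNIV_bool: "compact (UNIV :: bool set)"
  by (simp add: finite_imp_compact)

lemma continuous_on_bool_iff:
  fixes p :: "'a::topological_space \<Rightarrow> bool"
  shows "continuous_on S p \<longleftrightarrow>
    openin (top_of_set S) {x \<in> S. p x} \<and> openin (top_of_set S) {x \<in> S. \<not> p x}"
    (is "?L \<longleftrightarrow> ?R")
proof
  assume p: ?L
  have "S \<inter> p -` {True} = {x \<in> S. p x}" "S \<inter> p -` {False} = {x \<in> S. \<not> p x}"
    by auto
  with continuous_openin_preimage_gen[OF p, of "{True}"]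
    continuous_openin_preimage_gen[OF p, of "{False}"]
  show ?R by (simp add: open_discrete)
next
  assume r: ?R
  have "openin (top_of_set S) (S \<inter> p -` B)" for B
  proof -
    have "S \<inter> p -` B = (if True \<in> B then {x \<in> S. p x} else {}) \<union>
        (if False \<in> B then {x \<in> S. \<not> p x} else {})"
    proof (rule set_eqI)
      fix x show "x \<in> S \<inter> p -` B \<longleftrightarrow> x \<in> (if True \<in> B then {x \<in> S. p x} else {}) \<union>
        (if False \<in> B then {x \<in> S. \<not> p x} else {})"
        by (cases "p x") auto
    qed
    then show ?thesis using r by (auto intro: openin_Un)
  qed
  then show ?L by (simp add: continuous_on_open_gen[where T = UNIV])
qed

text \<open>In a compact Hausdorff space quasi-components are connected components: if no connected
  set meets both points, the cut-wire-fence theorem yields a clopen partition between them.\<close>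

lemma totally_disconnected_clopen_separation:
  fixes Y :: "'a::metric_space set"
  assumes "compact Y" "totally_disconnected Y" "x \<in> Y" "y \<in> Y" "x \<noteq> y"
  obtains U where "openin (top_of_set Y) U" "openin (top_of_set Y) (Y - U)" "x \<in> U" "y \<in> Y - U"
proof -
  have "separated_between (top_of_set Y) {x} {y}"
  proof (rule cut_wire_fence_theorem)
    show "compact_space (top_of_set Y)"
      using assms(1) by (simp add: compact_space_subtopology)
    show "Hausdorff_space (top_of_set Y)"
      by (simp add: Hausdorff_space_subtopology)
    show "closedin (top_of_set Y) {x}" "closedin (top_of_set Y) {y}"
      using assms by (auto intro: closed_subset)
    show "disjnt C {x} \<or> disjnt C {y}" if "connectedin (top_of_set Y) C" for C
    proof -
      have "connected C" "C \<subseteq> Y" using that by (auto simp: connectedin_subtopology)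
      then obtain a where "C \<subseteq> {a}" using assms(2) unfolding totally_disconnected_def by blast
      then show ?thesis using assms(5) by (auto simp: disjnt_def)
    qed
  qed
  then obtain U V where "openin (top_of_set Y) U" "openin (top_of_set Y) V"
    "U \<union> V = Y" "disjnt U V" "x \<in> U" "y \<in> V"
    by (auto simp: separated_between_def)
  moreover from this have "V = Y - U" by (auto simp: disjnt_def)
  ultimately show thesis using that by auto
qed

text \<open>The compact sets \<open>D n\<close> exhaust the pairs of distinct points. Finitely many
  boxes, each a clopen set times its complement, cover each \<open>D n\<close>, so countably many
  clopen sets separate all points; membership in them gives the digits.\<close>

lemma totally_disconnected_embedding:
  fixes Y :: "'a::metric_space set"
  assumes Y: "compact Y" "totally_disconnected Y"
  obtains e :: "'a \<Rightarrow> nat \<Rightarrow> bool" where "continuous_on Y e" "inj_on e Y" "\<And>y. \<not> e y 0"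
proof -
  define \<B> where "\<B> = {U. openin (top_of_set Y) U \<and> openin (top_of_set Y) (Y - U)}"
  define D where "D n = (Y \<times> Y) \<inter> {p. dist (fst p) (snd p) \<ge> inverse (real (Suc n))}" for n
  \<comment> \<open>Each box is relatively open in the square of \<open>Y\<close>. It is thickened
    here to an open set of the ambient product with the same trace, so that compactness of
    \<open>D n\<close> applies.\<close>
  define cell where "cell U = (SOME G. open G \<and> (Y \<times> Y) \<inter> G = U \<times> (Y - U))" for U
  have cell: "open (cell U)" "(Y \<times> Y) \<inter> cell U = U \<times> (Y - U)" if "U \<in> \<B>" for U
  proof -
    have U: "openin (top_of_set Y) U" "openin (top_of_set Y) (Y - U)"
      using that by (auto simp: \<B>_def)
    obtain A where A: "open A" "U = Y \<inter> A" using U(1) unfolding openin_open by blast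
    obtain B where B: "open B" "Y - U = Y \<inter> B" using U(2) unfolding openin_open by metis
    have "(Y \<times> Y) \<inter> (A \<times> B) = U \<times> (Y - U)"
      by (simp only: Times_Int_Times A(2)[symmetric] B(2)[symmetric])
    then have "open (A \<times> B) \<and> (Y \<times> Y) \<inter> (A \<times> B) = U \<times> (Y - U)"
      using A(1) B(1) by (simp add: open_Times)
    then have "open (cell U) \<and> (Y \<times> Y) \<inter> cell U = U \<times> (Y - U)"
      unfolding cell_def by (rule someI)
    then show "open (cell U)" "(Y \<times> Y) \<inter> cell U = U \<times> (Y - U)" by simp_all
  qed
  have "\<exists>\<F>. \<F> \<subseteq> \<B> \<and> finite \<F> \<and> D n \<subseteq> (\<Union>U\<in>\<F>. cell U)" for n
  proof -
    have "closed {p :: 'a \<times> 'a. dist (fst p) (snd p) \<ge> inverse (real (Suc n))}"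
      by (intro closed_Collect_le continuous_intros)
    then have cD: "compact (D n)"
      unfolding D_def using Y(1) by (intro compact_Int_closed compact_Times)
    have sub: "D n \<subseteq> (\<Union>U\<in>\<B>. cell U)"
    proof
      fix p assume p: "p \<in> D n"
      obtain x y where xy: "p = (x, y)" by (cases p)
      have "x \<in> Y" "y \<in> Y" "x \<noteq> y" using p xy by (auto simp: D_def)
      then obtain U where U: "openin (top_of_set Y) U" "openin (top_of_set Y) (Y - U)"
        "x \<in> U" "y \<in> Y - U"
        using totally_disconnected_clopen_separation[OF Y] by metis
      then have "U \<in> \<B>" by (simp add: \<B>_def)
      have "p \<in> cell U" using cell(2)[OF \<open>U \<in> \<B>\<close>] U xy by auto
      with \<open>U \<in> \<B>\<close> show "p \<in> (\<Union>U\<in>\<B>. cell U)" by auto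
    qed
    show ?thesis
      using compactE_image[OF cD _ sub] cell(1) by metis
  qed
  then obtain \<F> where \<F>: "\<And>n. \<F> n \<subseteq> \<B>" "\<And>n. finite (\<F> n)" "\<And>n. D n \<subseteq> (\<Union>U\<in>\<F> n. cell U)"
    by metis
  \<comment> \<open>The empty set is added only to make the family nonempty, so that
    \<open>from_nat_into\<close> enumerates all of it.\<close>
  define \<G> where "\<G> = insert {} (\<Union>n. \<F> n)"
  have "countable \<G>" unfolding \<G>_def using \<F>(2) by (auto intro: countable_finite)
  moreover have "\<G> \<noteq> {}" by (auto simp: \<G>_def)
  ultimately have u: "range (from_nat_into \<G>) = \<G>" by (rule range_from_nat_into[rotated])
  \<comment> \<open>Position 0 stays free for the markers; the membership digits start at position
    1.\<close>
  define e where "e y n = (case n of 0 \<Rightarrow> False | Suc m \<Rightarrow> y \<in> from_nat_into \<G> m)" for y n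
  have \<G>: "U \<in> \<B>" if "U \<in> \<G>" for U
    using that \<F>(1) by (auto simp: \<G>_def \<B>_def)
  show thesis
  proof
    show "continuous_on Y e"
    proof (rule continuous_on_coordinatewise_then_product)
      fix n
      show "continuous_on Y (\<lambda>y. e y n)"
      proof (cases n)
        case (Suc m)
        have "from_nat_into \<G> m \<in> \<B>" using \<G> u by blast
        then have "openin (top_of_set Y) (from_nat_into \<G> m)" "openin (top_of_set Y) (Y - from_nat_into \<G> m)"
          by (auto simp: \<B>_def)
        moreover from this have "{x \<in> Y. x \<in> from_nat_into \<G> m} = from_nat_into \<G> m"
          "{x \<in> Y. x \<notin> from_nat_into \<G> m} = Y - from_nat_into \<G> m"
          using openin_imp_subset by blast+
        ultimately show ?thesis
          by (simp add: e_def Suc continuous_on_bool_iff)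
      qed (simp add: e_def)
    qed
    show "inj_on e Y"
    proof (rule inj_onI, rule ccontr)
      fix x y assume xy: "x \<in> Y" "y \<in> Y" "e x = e y" "x \<noteq> y"
      obtain n where "inverse (real (Suc n)) < dist x y"
        using reals_Archimedean[of "dist x y"] xy by auto
      then have "(x, y) \<in> D n" using xy by (auto simp: D_def)
      then obtain U where U: "U \<in> \<F> n" "(x, y) \<in> cell U" using \<F>(3) by blast
      then have "x \<in> U" "y \<notin> U" using cell(2)[of U] \<F>(1) xy by blast+
      moreover obtain m where "U = from_nat_into \<G> m"
        using U(1) u unfolding \<G>_def by blast
      ultimately show False using fun_cong[OF xy(3), of "Suc m"] by (simp add: e_def)
    qed
  qed (simp add: e_def)
qed

section \<open>Building Cantor sets: injective parametrisations and finite disjoint unions\<close>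

lemma cantor_setI:
  fixes c :: "(nat \<Rightarrow> bool) \<Rightarrow> 'a::t2_space"
  assumes "continuous_on UNIV c" "inj c"
  shows "cantor_set (range c)"
proof -
  have "\<exists>g. homeomorphism UNIV (range c) c g"
    using assms compact_UNIV_fun[OF compact_UNIV_bool] by (intro homeomorphism_compact) auto
  then show ?thesis
    unfolding cantor_set_def by (metis homeomorphic_def homeomorphic_sym)
qed

lemma cantor_set_parametrisation:
  assumes "cantor_set C"
  obtains c :: "(nat \<Rightarrow> bool) \<Rightarrow> 'a::topological_space" where "continuous_on UNIV c" "inj c" "range c = C"
proof -
  obtain c d where "homeomorphism (UNIV :: (nat \<Rightarrow> bool) set) C c d"
    using assms unfolding cantor_set_def by (metis homeomorphic_def homeomorphic_sym)
  then show thesis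
    by (intro that[of c]) (auto simp: homeomorphism_def intro: inj_on_inverseI)
qed

text \<open>The space of binary sequences is two disjoint clopen copies of itself, told apart by the
  first digit: that digit selects the set and the tail is fed to its parametrisation.\<close>

lemma cantor_set_Un:
  fixes A B :: "'a::t2_space set"
  assumes "cantor_set A" "cantor_set B" "A \<inter> B = {}"
  shows "cantor_set (A \<union> B)"
proof -
  obtain a :: "(nat \<Rightarrow> bool) \<Rightarrow> 'a" where a: "continuous_on UNIV a" "inj a" "range a = A"
    using assms(1) by (rule cantor_set_parametrisation)
  obtain b :: "(nat \<Rightarrow> bool) \<Rightarrow> 'a" where b: "continuous_on UNIV b" "inj b" "range b = B"
    using assms(2) by (rule cantor_set_parametrisation)
  define tail :: "(nat \<Rightarrow> bool) \<Rightarrow> nat \<Rightarrow> bool" where "tail t = (\<lambda>n. t (Suc n))" for t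
  define c where "c t = (if t 0 then a (tail t) else b (tail t))" for t
  have tail: "continuous_on UNIV tail"
    unfolding tail_def by (intro continuous_on_coordinatewise_then_product) simp
  have cont: "continuous_on UNIV c"
  proof -
    have s: "continuous_on UNIV (\<lambda>t :: nat \<Rightarrow> bool. t 0)" by simp
    have cl: "closed {t :: nat \<Rightarrow> bool. t 0}" "closed {t :: nat \<Rightarrow> bool. \<not> t 0}"
      using s unfolding continuous_on_bool_iff by (auto simp: closed_def Collect_neg_eq[symmetric])
    have "continuous_on UNIV (\<lambda>t. a (tail t))" "continuous_on UNIV (\<lambda>t. b (tail t))"
      using continuous_on_compose2[OF a(1) tail] continuous_on_compose2[OF b(1) tail] by auto
    then have "continuous_on ({t. t 0} \<union> {t. \<not> t 0}) c"
      unfolding c_def by (intro continuous_on_cases cl) (auto intro: continuous_on_subset)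
    moreover have "{t. t 0} \<union> {t :: nat \<Rightarrow> bool. \<not> t 0} = UNIV" by auto
    ultimately show ?thesis by simp
  qed
  have "inj c"
  proof
    fix s t assume "c s = c t"
    then have st: "s 0 = t 0" "tail s = tail t"
      using a(2,3) b(2,3) assms(3) unfolding c_def by (auto simp: inj_eq split: if_splits)
    show "s = t"
    proof
      fix n show "s n = t n"
        using st(1) fun_cong[OF st(2)] by (cases n) (auto simp: tail_def)
    qed
  qed
  moreover have "range c = A \<union> B"
  proof
    show "A \<union> B \<subseteq> range c"
    proof
      fix x assume "x \<in> A \<union> B"
      then consider s where "x = a s" | s where "x = b s" using a b by auto
      then show "x \<in> range c"
      proof cases
        case 1
        then have "x = c (case_nat True s)" by (simp add: c_def tail_def)
        then show ?thesis by blast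
      next
        case 2
        then have "x = c (case_nat False s)" by (simp add: c_def tail_def)
        then show ?thesis by blast
      qed
    qed
  qed (use a b in \<open>auto simp: c_def\<close>)
  ultimately show ?thesis using cantor_setI[OF cont] by simp
qed

lemma cantor_set_UN:
  fixes A :: "'i \<Rightarrow> 'a::t2_space set"
  assumes "finite I" "I \<noteq> {}" "\<And>i. i \<in> I \<Longrightarrow> cantor_set (A i)" "disjoint_family_on A I"
  shows "cantor_set (\<Union>i\<in>I. A i)"
  using assms
proof (induction I rule: finite_ne_induct)
  case (insert i I)
  have "A i \<inter> (\<Union>j\<in>I. A j) = {}"
    using insert.prems(2) insert.hyps by (fastforce simp: disjoint_family_on_def)
  moreover have "cantor_set (\<Union>j\<in>I. A j)"
    using insert by (auto simp: disjoint_family_on_def)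
  ultimately show ?case
    using cantor_set_Un[of "A i"] insert.prems(1) by simp
qed simp

subsection \<open>The full shift and the quotient by a natural extension\<close>

definition shift :: "int \<Rightarrow> (int \<Rightarrow> 'a) \<Rightarrow> int \<Rightarrow> 'a" where
  "shift k x = (\<lambda>i. x (i + k))"

lemma shift_0 [simp]: "shift 0 x = x"
  by (simp add: shift_def)

lemma shift_shift [simp]: "shift a (shift b x) = shift (a + b) x"
  by (simp add: shift_def add.assoc)

lemma continuous_on_shift:
  "continuous_on UNIV (shift k :: (int \<Rightarrow> 'a::topological_space) \<Rightarrow> _)"
  unfolding shift_def by (intro continuous_on_coordinatewise_then_product) simp

text \<open>The sets \<open>{z. agree k x z}\<close> form a neighbourhood basis at \<open>x\<close>,
  so agreement on windows replaces a metric on the two-sided shift. One number \<open>k\<close>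
  bounds both the position and the digit level.\<close>

definition agree :: "nat \<Rightarrow> (int \<Rightarrow> nat \<Rightarrow> bool) \<Rightarrow> (int \<Rightarrow> nat \<Rightarrow> bool) \<Rightarrow> bool" where
  "agree k x z \<longleftrightarrow> (\<forall>i n. \<bar>i\<bar> \<le> int k \<and> n \<le> k \<longrightarrow> x i n = z i n)"

lemma agree_refl [simp]: "agree k x x"
  by (simp add: agree_def)

lemma agree_sym: "agree k x z \<Longrightarrow> agree k z x"
  by (simp add: agree_def)

lemma agree_trans: "agree k x y \<Longrightarrow> agree k y z \<Longrightarrow> agree k x z"
  by (simp add: agree_def)

lemma agree_mono: "agree k x z \<Longrightarrow> l \<le> k \<Longrightarrow> agree l x z"
  by (auto simp: agree_def)

lemma agree_shift:
  assumes "agree (k + N) x z" "\<bar>i\<bar> \<le> int N"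
  shows "agree k (shift i x) (shift i z)"
  using assms by (auto simp: agree_def shift_def)

lemma finite_agree_window: "finite {(i, n). \<bar>i\<bar> \<le> int k \<and> n \<le> k}"
proof -
  have "{(i, n). \<bar>i\<bar> \<le> int k \<and> n \<le> k} \<subseteq> {- int k..int k} \<times> {..k}" by auto
  then show ?thesis by (rule finite_subset) simp
qed

lemma open_agree: "open {z. agree k x z}"
proof -
  have "open {z :: int \<Rightarrow> nat \<Rightarrow> bool. x i n = z i n}" for i n
  proof -
    have "continuous_on UNIV (\<lambda>z :: int \<Rightarrow> nat \<Rightarrow> bool. z i n)"
      by (intro continuous_on_product_then_coordinatewise[of UNIV "\<lambda>z. z i"]) simp
    then show ?thesis
      using open_vimage[of "{x i n}" "\<lambda>z. z i n"] by (simp add: open_discrete vimage_def eq_commute)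
  qed
  then have "open (\<Inter>p\<in>{(i, n). \<bar>i\<bar> \<le> int k \<and> n \<le> k}. {z. x (fst p) (snd p) = z (fst p) (snd p)})"
    by (intro open_INT finite_agree_window) auto
  moreover have "{z. agree k x z} =
      (\<Inter>p\<in>{(i, n). \<bar>i\<bar> \<le> int k \<and> n \<le> k}. {z. x (fst p) (snd p) = z (fst p) (snd p)})"
    by (auto simp: agree_def)
  ultimately show ?thesis by simp
qed

text \<open>A continuous map from a compact space to a Hausdorff space is closed: the image under
  \<open>\<Phi>\<close> of the closed set on which \<open>h\<close> lies in \<open>B\<close> is
  closed, and its trace on \<open>S\<close> is the preimage of \<open>B\<close> under
  \<open>q\<close>. This gives continuity of the induced map and, on a set that need not be compact,
  of its inverse.\<close>

lemma continuous_on_factor_compact: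
  fixes \<Phi> :: "'w::topological_space \<Rightarrow> 'b::t2_space" and h :: "'w \<Rightarrow> 'c::topological_space"
  assumes "compact (UNIV :: 'w set)" "continuous_on UNIV \<Phi>" "continuous_on UNIV h"
    and S: "S \<subseteq> range \<Phi>" and q: "\<And>x. \<Phi> x \<in> S \<Longrightarrow> q (\<Phi> x) = h x"
  shows "continuous_on S q"
  unfolding continuous_on_closed_invariant
proof (intro allI impI)
  fix B :: "'c set" assume "closed B"
  then have "closed (h -` B)" using assms(3) by (simp add: continuous_on_closed_vimage)
  then have "compact (UNIV \<inter> h -` B)" by (rule compact_Int_closed[OF assms(1)])
  then have "closed (\<Phi> ` (h -` B))"
    using compact_continuous_image[of "h -` B" \<Phi>] assms(2) compact_imp_closed
    by (auto intro: continuous_on_subset)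
  moreover have "\<Phi> ` (h -` B) \<inter> S = q -` B \<inter> S" using S q by fastforce
  ultimately show "\<exists>A. closed A \<and> A \<inter> S = q -` B \<inter> S" by blast
qed

lemma dist_fun_less_if_agree:
  assumes "\<epsilon> > 0"
  obtains n where "\<And>z w :: nat \<Rightarrow> 'a::metric_space. (\<And>m. m \<le> n \<Longrightarrow> z m = w m) \<Longrightarrow> dist z w < \<epsilon>"
proof -
  obtain N where N: "(1/2 :: real) ^ N < \<epsilon>"
    using real_arch_pow_inv[of \<epsilon> "1/2"] assms by auto
  \<comment> \<open>The metric on functions weighs the coordinates in the order of
    \<open>from_nat\<close>, so \<open>n\<close> bounds the indices of its first
    \<open>N + 1\<close> terms; the remaining terms contribute at most
    \<open>(1/2) ^ N\<close>.\<close>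
  define n where "n = Max (from_nat ` {..N} :: nat set)"
  have "dist z w < \<epsilon>" if zw: "\<And>m. m \<le> n \<Longrightarrow> z m = w m" for z w :: "nat \<Rightarrow> 'a"
  proof -
    have "dist (z (from_nat i)) (w (from_nat i)) = 0" if "i \<le> N" for i
      using that by (simp add: zw n_def)
    then have "{dist (z (from_nat i)) (w (from_nat i)) |i. i \<le> N} = {0}" by force
    then show ?thesis using dist_fun_le_dist_first_terms[of z w N] N by simp
  qed
  then show thesis by (rule that)
qed

text \<open>Finite lists of conditions form a countable type, so cylinders can serve as coordinate
  indices of \<open>proj\<close>.\<close>

definition cylinder :: "(int \<times> nat \<times> bool) list \<Rightarrow> (int \<Rightarrow> nat \<Rightarrow> bool) set" where
  "cylinder l = {x. \<forall>(i, n, b)\<in>set l. x i n = b}"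

lemma cylinder_agree: "\<exists>l. cylinder l = {z. agree k x z}"
proof -
  let ?A = "(\<lambda>(i, n). (i, n, x i n)) ` {(i, n). \<bar>i\<bar> \<le> int k \<and> n \<le> k}"
  obtain l where "set l = ?A" using finite_list[OF finite_imageI[OF finite_agree_window]] by metis
  then have "cylinder l = {z. agree k x z}" by (auto simp: cylinder_def agree_def)
  then show ?thesis by blast
qed

lemma cylinder_depends_on_window: "\<exists>k. \<forall>x z. agree k x z \<longrightarrow> (x \<in> cylinder l \<longleftrightarrow> z \<in> cylinder l)"
proof (induction l)
  case (Cons p l)
  then obtain k where k: "\<And>x z. agree k x z \<Longrightarrow> x \<in> cylinder l \<longleftrightarrow> z \<in> cylinder l" by blast
  obtain i n b where p: "p = (i, n, b)" by (cases p)
  have "x \<in> cylinder (p # l) \<longleftrightarrow> z \<in> cylinder (p # l)" if "agree (k + nat \<bar>i\<bar> + n) x z" for x z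
  proof -
    have "agree k x z" using that by (rule agree_mono) simp
    moreover have "x i n = z i n" using that by (auto simp: agree_def)
    ultimately show ?thesis using k by (auto simp: cylinder_def p)
  qed
  then show ?case by blast
qed (simp add: cylinder_def)

text \<open>Digit 0 is reserved: it vanishes on codes of points of \<open>Y\<close> and is set by the markers of
  \<open>chaotic_point\<close>, which keeps the chaotic set off the natural extension.\<close>

locale coded_system =
  fixes Y :: "'a::metric_space set" and g :: "'a \<Rightarrow> 'a" and e :: "'a \<Rightarrow> nat \<Rightarrow> bool"
  assumes compact_Y: "compact Y" and cont_g: "continuous_on Y g" and surj_g: "g ` Y = Y"
    and cont_e: "continuous_on Y e" and inj_e: "inj_on e Y" and e_0: "\<not> e y 0"
begin

section \<open>The natural extension as a closed shift-invariant set\<close>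

lemma funpow_g: "y \<in> Y \<Longrightarrow> (g ^^ j) y \<in> Y"
proof (induction j)
  case (Suc j)
  then have "g ((g ^^ j) y) \<in> g ` Y" by blast
  then show ?case unfolding surj_g by simp
qed simp

lemma cont_orbit: "continuous_on Y (\<lambda>y. e ((g ^^ j) y) n)"
proof -
  have "continuous_on Y (g ^^ j)"
  proof (induction j)
    case (Suc j)
    show ?case
      using continuous_on_compose2[OF cont_g Suc image_subsetI[OF funpow_g]] by (simp add: o_def)
  qed simp
  then have "continuous_on Y (\<lambda>y. e ((g ^^ j) y))"
    by (rule continuous_on_compose2[OF cont_e _ image_subsetI[OF funpow_g]])
  then show ?thesis by (rule continuous_on_product_then_coordinatewise)
qed

text \<open>Every tail has to be the coded forward orbit of some point of \<open>Y\<close>. Since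
  \<open>e\<close> is injective on \<open>Y\<close>, the points belonging to successive positions
  are successive images under \<open>g\<close>, so this is the inverse limit of
  \<open>(Y, g)\<close>.\<close>

definition natext :: "(int \<Rightarrow> nat \<Rightarrow> bool) set" where
  "natext = {x. \<forall>i. \<exists>y\<in>Y. \<forall>j. x (i + int j) = e ((g ^^ j) y)}"

lemma natext_level_0: "x \<in> natext \<Longrightarrow> \<not> x i 0"
proof -
  assume "x \<in> natext"
  then obtain y where "x (i + int 0) = e ((g ^^ 0) y)" unfolding natext_def by blast
  then show ?thesis using e_0 by simp
qed

lemma natext_shiftI: "x \<in> natext \<Longrightarrow> shift k x \<in> natext"
proof -
  assume x: "x \<in> natext"
  have "\<exists>y\<in>Y. \<forall>j. shift k x (i + int j) = e ((g ^^ j) y)" for i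
  proof -
    obtain y where y: "y \<in> Y" "\<And>j. x (i + k + int j) = e ((g ^^ j) y)"
      using x unfolding natext_def by blast
    have "shift k x (i + int j) = e ((g ^^ j) y)" for j
      using y(2)[of j] by (simp add: shift_def algebra_simps)
    with y(1) show ?thesis by blast
  qed
  then show ?thesis by (simp add: natext_def)
qed

lemma natext_shift [simp]: "shift k x \<in> natext \<longleftrightarrow> x \<in> natext"
  using natext_shiftI[of x k] natext_shiftI[of "shift k x" "-k"] by auto

text \<open>Surjectivity of \<open>g\<close> lets every forward orbit be continued backwards inside
  \<open>Y\<close> by choosing preimages.\<close>

lemma natext_through:
  assumes "y \<in> Y"
  obtains x where "x \<in> natext" "\<And>j. x (int j) = e ((g ^^ j) y)"
proof -
  define p where "p = rec_nat y (\<lambda>_ z. inv_into Y g z)"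
  have p: "p n \<in> Y" for n
    by (induction n) (use assms surj_g in \<open>auto simp: p_def inv_into_into\<close>)
  have gp: "g (p (Suc n)) = p n" for n
    using f_inv_into_f[of "p n" g Y] p surj_g by (simp add: p_def)
  \<comment> \<open>Moving forward from \<open>p n\<close> retraces the chosen preimages and, after
    \<open>n\<close> steps, continues along the orbit of \<open>y\<close>.\<close>
  have pow: "(g ^^ j) (p n) = (if j \<le> n then p (n - j) else (g ^^ (j - n)) y)" for j n
  proof (induction j)
    case (Suc j)
    have "g (p (n - j)) = p (n - Suc j)" if "j < n"
      using gp[of "n - Suc j"] that by (simp add: Suc_diff_Suc)
    moreover have "p 0 = y" by (simp add: p_def)
    ultimately show ?case using Suc by (auto simp: Suc_diff_le not_le less_Suc_eq)
  qed simp
  \<comment> \<open>As \<open>nat\<close> sends negative integers to 0, exactly one of the two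
    indices can be nonzero: positions at or after 0 follow the orbit of \<open>y = p 0\<close>,
    earlier ones the chosen preimages.\<close>
  define x where "x i = e ((g ^^ nat i) (p (nat (- i))))" for i
  have "x \<in> natext"
    unfolding natext_def
  proof clarify
    fix i :: int
    show "\<exists>y\<in>Y. \<forall>j. x (i + int j) = e ((g ^^ j) y)"
    proof (intro bexI allI)
      fix j
      show "x (i + int j) = e ((g ^^ j) ((g ^^ nat i) (p (nat (- i)))))"
      proof (cases "i \<ge> 0")
        case True
        then have "nat (i + int j) = j + nat i" "nat (- i) = 0" "nat (- i - int j) = 0" by auto
        then show ?thesis by (simp add: x_def funpow_add)
      next
        case False
        define m where "m = nat (- i)"
        have m: "i = - int m" "nat i = 0" using False by (simp_all add: m_def)
        show ?thesis
        proof (cases "j \<le> m")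
          case True
          then have "nat (i + int j) = 0" "nat (- (i + int j)) = m - j" using m by auto
          then show ?thesis using True by (simp add: x_def pow m flip: m_def)
        next
          case False
          then have "nat (i + int j) = j - m" "nat (- (i + int j)) = 0" using m by auto
          moreover have "p 0 = y" by (simp add: p_def)
          ultimately show ?thesis using False by (simp add: x_def pow m flip: m_def)
        qed
      qed
    qed (simp add: p funpow_g)
  qed
  moreover have "x (int j) = e ((g ^^ j) y)" for j
    by (simp add: x_def p_def)
  ultimately show thesis by (rule that)
qed

text \<open>At some position \<open>i\<close> every candidate \<open>y\<close> is refuted by a
  single digit of \<open>x\<close>. Each digit refutes a relatively open set of candidates, so by
  compactness of \<open>Y\<close> finitely many digits refute them all, and a window containing
  these digits does the job.\<close>

lemma natext_closed:
  assumes "x \<notin> natext"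
  obtains k where "\<And>z. agree k x z \<Longrightarrow> z \<notin> natext"
proof -
  obtain i where i: "\<And>y. y \<in> Y \<Longrightarrow> \<exists>j. x (i + int j) \<noteq> e ((g ^^ j) y)"
    using assms unfolding natext_def by blast
  define G where "G = (\<lambda>(j, n). {y \<in> Y. e ((g ^^ j) y) n \<noteq> x (i + int j) n})"
  have "openin (top_of_set Y) (G p)" for p
  proof -
    obtain j n where p: "p = (j, n)" by (cases p)
    have "G p = (if x (i + int j) n then {y \<in> Y. \<not> e ((g ^^ j) y) n} else {y \<in> Y. e ((g ^^ j) y) n})"
      by (auto simp: G_def p)
    then show ?thesis
      using cont_orbit[of j n] unfolding continuous_on_bool_iff by simp
  qed
  then have op: "\<forall>T\<in>range G. openin (top_of_set Y) T" by blast
  have cov: "Y \<subseteq> \<Union>(range G)"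
  proof
    fix y assume "y \<in> Y"
    then obtain j where "x (i + int j) \<noteq> e ((g ^^ j) y)" using i by blast
    then obtain n where "x (i + int j) n \<noteq> e ((g ^^ j) y) n" by (auto simp: fun_eq_iff)
    then have "y \<in> G (j, n)" using \<open>y \<in> Y\<close> by (auto simp: G_def)
    then show "y \<in> \<Union>(range G)" by blast
  qed
  obtain \<D> where D: "\<D> \<subseteq> range G" "finite \<D>" "Y \<subseteq> \<Union>\<D>"
    using compact_Y[unfolded compact_eq_openin_cover, rule_format, of "range G"] op cov by blast
  obtain P where "finite P" "\<D> = G ` P" using finite_subset_image[OF D(2,1)] by blast
  with D(3) have P: "finite P" "Y \<subseteq> (\<Union>p\<in>P. G p)" by simp_all
  have "\<exists>k. \<forall>(j, n)\<in>P. \<bar>i + int j\<bar> \<le> int k \<and> n \<le> k"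
    using P(1)
  proof (induction P)
    case (insert p P)
    then obtain k where k: "\<And>j n. (j, n) \<in> P \<Longrightarrow> \<bar>i + int j\<bar> \<le> int k \<and> n \<le> k" by auto
    obtain j n where p: "p = (j, n)" by (cases p)
    define k' where "k' = k + nat \<bar>i + int j\<bar> + n"
    have "\<bar>i + int j'\<bar> \<le> int k' \<and> n' \<le> k'" if "(j', n') \<in> insert p P" for j' n'
    proof (cases "(j', n') \<in> P")
      case True
      then show ?thesis using k[of j' n'] unfolding k'_def by linarith
    next
      case False
      then show ?thesis using that unfolding k'_def p by auto
    qed
    then show ?case by blast
  qed simp
  then obtain k where k: "\<And>j n. (j, n) \<in> P \<Longrightarrow> \<bar>i + int j\<bar> \<le> int k \<and> n \<le> k" by blast
  have "z \<notin> natext" if "agree k x z" for z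
  proof
    assume "z \<in> natext"
    then obtain y where y: "y \<in> Y" "\<And>j. z (i + int j) = e ((g ^^ j) y)"
      unfolding natext_def by blast
    then obtain j n where jn: "(j, n) \<in> P" "y \<in> G (j, n)" using P(2) by fast
    then have "z (i + int j) n \<noteq> x (i + int j) n" using y by (simp add: G_def)
    moreover have "x (i + int j) n = z (i + int j) n"
      using that k[OF jn(1)] by (simp add: agree_def)
    ultimately show False by simp
  qed
  then show thesis by (rule that)
qed

section \<open>The quotient map onto the extension\<close>

text \<open>The \<open>Inl\<close> coordinates record the forward half of a point.  The \<open>Inr\<close> coordinates vanish on the
  natural extension and separate each point outside it from all others.\<close>

definition proj :: "(int \<Rightarrow> nat \<Rightarrow> bool) \<Rightarrow> nat \<Rightarrow> real" where
  "proj x m = (case (from_nat m :: (nat \<times> nat) + (int \<times> nat \<times> bool) list) of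
     Inl (i, n) \<Rightarrow> of_bool (x (int i) n)
   | Inr l \<Rightarrow> of_bool (x \<in> cylinder l \<and> cylinder l \<inter> natext = {}))"

lemma proj_Inl: "proj x (to_nat (Inl (i, n) :: (nat \<times> nat) + (int \<times> nat \<times> bool) list)) = of_bool (x (int i) n)"
  by (simp add: proj_def)

lemma proj_Inr: "proj x (to_nat (Inr l :: (nat \<times> nat) + (int \<times> nat \<times> bool) list)) =
    of_bool (x \<in> cylinder l \<and> cylinder l \<inter> natext = {})"
  by (simp add: proj_def)

lemma proj_natext:
  assumes "x \<in> natext"
  shows "proj x m = (case (from_nat m :: (nat \<times> nat) + (int \<times> nat \<times> bool) list) of
     Inl (i, n) \<Rightarrow> of_bool (x (int i) n) | Inr l \<Rightarrow> 0)"
  using assms by (auto simp: proj_def split: sum.split)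

lemma proj_values: "proj x m \<in> {0, 1}"
  by (auto simp: proj_def split: sum.split)

text \<open>Choose a cylinder around \<open>x\<close> that misses \<open>natext\<close> and also
  sees a digit where \<open>z\<close> differs; its \<open>Inr\<close> coordinate is 1 at
  \<open>x\<close> and 0 at \<open>z\<close>. This works whether or not \<open>z\<close> lies in
  \<open>natext\<close>.\<close>

lemma proj_eq_outside:
  assumes "proj x = proj z" "x \<notin> natext"
  shows "x = z"
proof (rule ccontr)
  assume "x \<noteq> z"
  then obtain i n where i: "x i n \<noteq> z i n" by (auto simp: fun_eq_iff)
  obtain k where k: "\<And>w. agree k x w \<Longrightarrow> w \<notin> natext" using natext_closed[OF assms(2)] by blast
  obtain l where l: "cylinder l = {w. agree (k + nat \<bar>i\<bar> + n) x w}" using cylinder_agree by blast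
  have "cylinder l \<inter> natext = {}" using k l by (auto dest: agree_mono[where l = k])
  moreover have "x \<in> cylinder l" using l by simp
  moreover have "z \<notin> cylinder l"
  proof
    assume "z \<in> cylinder l"
    then have "x i n = z i n" unfolding l by (simp add: agree_def)
    then show False using i by simp
  qed
  ultimately show False
    using fun_cong[OF assms(1), of "to_nat (Inr l :: (nat \<times> nat) + (int \<times> nat \<times> bool) list)"]
    by (simp add: proj_Inr)
qed

lemma proj_eq_forward:
  assumes "proj x = proj z"
  shows "x (int j) = z (int j)"
proof
  fix n show "x (int j) n = z (int j) n"
    using fun_cong[OF assms, of "to_nat (Inl (j, n) :: (nat \<times> nat) + (int \<times> nat \<times> bool) list)"]
    by (simp add: proj_Inl of_bool_eq_iff)
qed

text \<open>On \<open>natext\<close> the forward half determines the forward half of the shifted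
  point, and all other fibres are singletons. Hence the shift descends to the quotient, and the
  choice of representative in \<open>ext_map\<close> is immaterial.\<close>

lemma proj_shift:
  assumes "proj x = proj z"
  shows "proj (shift 1 x) = proj (shift 1 z)"
proof (cases "x \<in> natext \<and> z \<in> natext")
  case True
  have "shift 1 x (int j) = shift 1 z (int j)" for j
    using proj_eq_forward[OF assms, of "Suc j"] by (simp add: shift_def add.commute)
  then show ?thesis using True by (auto simp: proj_natext fun_eq_iff split: sum.split)
next
  case False
  then have "x = z" using proj_eq_outside[of x z] proj_eq_outside[of z x] assms by metis
  then show ?thesis by simp
qed

lemma proj_coordinate: "\<exists>k. \<forall>x z. agree k x z \<longrightarrow> proj x m = proj z m"
proof (cases "from_nat m :: (nat \<times> nat) + (int \<times> nat \<times> bool) list")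
  case (Inl p)
  obtain i n where p: "p = (i, n)" by (cases p)
  have "proj x m = proj z m" if "agree (i + n) x z" for x z
    using that by (simp add: proj_def Inl p agree_def)
  then show ?thesis by blast
next
  case (Inr l)
  obtain k where "\<And>x z. agree k x z \<Longrightarrow> x \<in> cylinder l \<longleftrightarrow> z \<in> cylinder l"
    using cylinder_depends_on_window by blast
  then have "proj x m = proj z m" if "agree k x z" for x z
    using that by (simp add: proj_def Inr)
  then show ?thesis by blast
qed

text \<open>Only finitely many coordinates matter up to \<open>\<epsilon>\<close>, and each depends
  on a finite window. All later metric estimates reduce to agreement on windows through this
  lemma.\<close>

lemma proj_uniform:
  assumes "\<epsilon> > 0"
  obtains k where "\<And>x z. agree k x z \<Longrightarrow> dist (proj x) (proj z) < \<epsilon>"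
proof -
  obtain n where n: "\<And>z w :: nat \<Rightarrow> real. (\<And>m. m \<le> n \<Longrightarrow> z m = w m) \<Longrightarrow> dist z w < \<epsilon>"
    using dist_fun_less_if_agree[OF assms] by metis
  obtain k where k: "\<And>m x z. agree (k m) x z \<Longrightarrow> proj x m = proj z m"
    using proj_coordinate by metis
  have "dist (proj x) (proj z) < \<epsilon>" if "agree (Max (k ` {..n})) x z" for x z
  proof (rule n)
    fix m assume "m \<le> n"
    then have "agree (k m) x z" by (intro agree_mono[OF that]) simp
    then show "proj x m = proj z m" by (rule k)
  qed
  then show thesis by (rule that)
qed

lemma continuous_on_proj: "continuous_on UNIV proj"
proof (rule continuous_on_open_vimage[THEN iffD2, OF open_UNIV], intro allI impI)
  fix U :: "(nat \<Rightarrow> real) set" assume "open U"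
  have "\<exists>T. open T \<and> x \<in> T \<and> T \<subseteq> proj -` U" if "x \<in> proj -` U" for x
  proof -
    have "proj x \<in> U" using that by simp
    with \<open>open U\<close> obtain \<epsilon> where e: "\<epsilon> > 0" "ball (proj x) \<epsilon> \<subseteq> U"
      by (rule openE)
    obtain k where "\<And>x z. agree k x z \<Longrightarrow> dist (proj x) (proj z) < \<epsilon>"
      using proj_uniform[OF e(1)] by metis
    then have "{z. agree k x z} \<subseteq> proj -` U" using e(2) by (auto simp: subset_iff)
    then show ?thesis by (intro exI[of _ "{z. agree k x z}"]) (simp add: open_agree)
  qed
  then have "open (proj -` U)" by (rule Topological_Spaces.openI)
  then show "open (proj -` U \<inter> UNIV)" by simp
qed

lemma compact_range_proj: "compact (range proj)"
  by (rule compact_continuous_image[OF continuous_on_proj compact_UNIV_fun[OF compact_UNIV_fun[OF compact_UNIV_bool]]])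

text \<open>Each coordinate maps a connected set onto a connected subset of \<open>{0, 1}\<close>,
  so all coordinates are constant on it.\<close>

lemma totally_disconnected_range_proj: "totally_disconnected (range proj)"
  unfolding totally_disconnected_def
proof (intro allI impI)
  fix S :: "(nat \<Rightarrow> real) set" assume S: "S \<subseteq> range proj \<and> connected S"
  have "z = w" if "z \<in> S" "w \<in> S" for z w
  proof
    fix m
    have "connected ((\<lambda>z. z m) ` S)"
      using S by (intro connected_continuous_image) (auto intro: continuous_on_subset[OF continuous_on_product_coordinates])
    moreover have "(\<lambda>z. z m) ` S \<subseteq> {0, 1}" using S proj_values by blast
    then have "finite ((\<lambda>z. z m) ` S)" by (rule finite_subset) simp
    ultimately show "z m = w m"
      using that connected_finite_iff_sing[of "(\<lambda>z. z m) ` S"] by (metis empty_iff image_eqI singletonD)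
  qed
  then show "\<exists>a. S \<subseteq> {a}" by blast
qed

section \<open>The map induced by the shift on the quotient\<close>

definition ext_map :: "(nat \<Rightarrow> real) \<Rightarrow> nat \<Rightarrow> real" where
  "ext_map z = proj (shift 1 (SOME x. proj x = z))"

lemma ext_map_proj: "ext_map (proj x) = proj (shift 1 x)"
  unfolding ext_map_def by (rule proj_shift, rule someI[where P = "\<lambda>y. proj y = proj x"], rule refl)

lemma ext_map_funpow: "(ext_map ^^ n) (proj x) = proj (shift (int n) x)"
  by (induction n) (simp_all add: ext_map_proj)

lemma ext_map_image: "ext_map ` proj ` A = proj ` shift 1 ` A"
  by (simp add: image_image ext_map_proj)

lemma shift_image_natext: "shift k ` natext = natext"
proof
  show "natext \<subseteq> shift k ` natext"
  proof
    fix x assume "x \<in> natext"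
    then have "x = shift k (shift (-k) x)" "shift (-k) x \<in> natext" by simp_all
    then show "x \<in> shift k ` natext" by blast
  qed
qed auto

lemma zero_dimensional_system_ext_map: "zero_dimensional_system (range proj) ext_map"
proof -
  have "continuous_on (range proj) ext_map"
  proof (rule continuous_on_factor_compact[where \<Phi> = proj and h = "\<lambda>x. proj (shift 1 x)"])
    show "continuous_on UNIV (\<lambda>x. proj (shift 1 x))"
      using continuous_on_compose2[OF continuous_on_proj continuous_on_shift] by simp
  qed (auto simp: ext_map_proj intro: continuous_on_proj compact_UNIV_fun compact_UNIV_bool)
  moreover have "range (shift 1 :: (int \<Rightarrow> nat \<Rightarrow> bool) \<Rightarrow> _) = UNIV"
    by (rule surjI[of _ "shift (-1)"]) simp
  then have "ext_map ` range proj = range proj" by (simp add: ext_map_image)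
  ultimately show ?thesis
    using compact_range_proj totally_disconnected_range_proj
    by (simp add: zero_dimensional_system_def dynamical_system_def)
qed

lemma proj_in_natext [simp]: "proj x \<in> proj ` natext \<longleftrightarrow> x \<in> natext"
  using proj_eq_outside by blast

section \<open>Identification of \<open>Y\<close> with the image of the natural extension\<close>

definition code :: "'a \<Rightarrow> nat \<Rightarrow> real" where
  "code y m = (case (from_nat m :: (nat \<times> nat) + (int \<times> nat \<times> bool) list) of
     Inl (i, n) \<Rightarrow> of_bool (e ((g ^^ i) y) n) | Inr l \<Rightarrow> 0)"

text \<open>Points of \<open>natext\<close> over the same \<open>y\<close> may differ only at
  negative positions, which \<open>proj\<close> does not record on \<open>natext\<close>.\<close>

lemma proj_eq_code:
  assumes "x \<in> natext" "\<And>j. x (int j) = e ((g ^^ j) y)"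
  shows "proj x = code y"
  unfolding fun_eq_iff proj_natext[OF assms(1)] code_def using assms(2)
  by (auto split: sum.split)

lemma code_image: "code ` Y = proj ` natext"
proof
  show "code ` Y \<subseteq> proj ` natext"
  proof
    fix z assume "z \<in> code ` Y"
    then obtain y where y: "y \<in> Y" "z = code y" by blast
    obtain x where x: "x \<in> natext" "\<And>j. x (int j) = e ((g ^^ j) y)"
      using natext_through[OF y(1)] by blast
    then have "z = proj x" using proj_eq_code y(2) by simp
    then show "z \<in> proj ` natext" using x(1) by blast
  qed
  show "proj ` natext \<subseteq> code ` Y"
  proof
    fix z assume "z \<in> proj ` natext"
    then obtain x where x: "x \<in> natext" "z = proj x" by blast
    then have "\<exists>y\<in>Y. \<forall>j. x (0 + int j) = e ((g ^^ j) y)" unfolding natext_def by blast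
    then obtain y where y: "y \<in> Y" "\<And>j. x (int j) = e ((g ^^ j) y)" by auto
    then have "z = code y" using proj_eq_code[OF x(1)] x(2) by simp
    then show "z \<in> code ` Y" using y(1) by (rule image_eqI)
  qed
qed

lemma continuous_on_code: "continuous_on Y code"
proof (rule continuous_on_coordinatewise_then_product)
  fix m
  have c: "continuous_on Y (\<lambda>y. of_bool (e ((g ^^ i) y) n) :: real)" for i n
    by (rule continuous_on_compose2[OF _ cont_orbit, of UNIV "of_bool :: bool \<Rightarrow> real"])
      (auto intro: continuous_on_discrete)
  show "continuous_on Y (\<lambda>y. code y m)"
    unfolding code_def
    by (cases "from_nat m :: (nat \<times> nat) + (int \<times> nat \<times> bool) list") (auto simp: c split: prod.split)
qed

lemma inj_on_code: "inj_on code Y"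
proof (rule inj_onI)
  fix x y assume xy: "x \<in> Y" "y \<in> Y" "code x = code y"
  have "e x n = e y n" for n
    using fun_cong[OF xy(3), of "to_nat (Inl (0, n) :: (nat \<times> nat) + (int \<times> nat \<times> bool) list)"]
    by (simp add: code_def of_bool_eq_iff)
  then have "e x = e y" by (rule ext)
  then show "x = y" using xy inj_e by (simp add: inj_on_eq_iff)
qed

text \<open>Compactness of \<open>Y\<close> makes the injection \<open>code\<close> a homeomorphism
  onto its image. It is equivariant because shifting a coded orbit of \<open>y\<close> by one leaves
  a coded orbit of \<open>g y\<close>.\<close>

lemma topologically_conjugate_natext: "topologically_conjugate Y g (proj ` natext) ext_map"
proof -
  obtain h' where "homeomorphism Y (proj ` natext) code h'"
    using homeomorphism_compact[OF compact_Y continuous_on_code code_image inj_on_code] by blast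
  moreover have "code (g y) = ext_map (code y)" if y: "y \<in> Y" for y
  proof -
    obtain x where x: "x \<in> natext" "\<And>j. x (int j) = e ((g ^^ j) y)"
      using natext_through[OF y] by blast
    have "shift 1 x (int j) = e ((g ^^ j) (g y))" for j
      using x(2)[of "Suc j"] by (simp add: shift_def add.commute funpow_swap1)
    then have "proj (shift 1 x) = code (g y)" using x by (intro proj_eq_code) simp_all
    then show ?thesis using proj_eq_code[OF x] ext_map_proj by metis
  qed
  ultimately show ?thesis unfolding topologically_conjugate_def by blast
qed

lemma subsystem_natext: "subsystem (proj ` natext) (range proj) ext_map"
proof -
  have "compact (code ` Y)" by (rule compact_continuous_image[OF continuous_on_code compact_Y])
  then have "closed (proj ` natext)" unfolding code_image by (rule compact_imp_closed)
  then show ?thesis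
    unfolding subsystem_def by (auto simp: ext_map_image shift_image_natext)
qed

section \<open>Invertibility outside the natural extension\<close>

abbreviation "outer \<equiv> range proj - proj ` natext"

lemma proj_in_outer [simp]: "proj x \<in> outer \<longleftrightarrow> x \<notin> natext"
  by simp

lemma inj_on_ext_map: "inj_on ext_map outer"
proof (rule inj_onI)
  fix z w assume zw: "z \<in> outer" "w \<in> outer" "ext_map z = ext_map w"
  then obtain x y where xy: "z = proj x" "w = proj y" "x \<notin> natext" by auto
  then have "shift 1 x = shift 1 y" using zw(3) by (intro proj_eq_outside) (simp_all add: ext_map_proj)
  then have "shift (-1) (shift 1 x) = shift (-1) (shift 1 y)" by simp
  then show "z = w" by (simp add: xy)
qed

lemma inv_ext_map: "x \<notin> natext \<Longrightarrow> inv_into outer ext_map (proj x) = proj (shift (-1) x)"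
  using inv_into_f_f[OF inj_on_ext_map, of "proj (shift (-1) x)"] by (simp add: ext_map_proj)

lemma inv_ext_map_funpow: "x \<notin> natext \<Longrightarrow> (inv_into outer ext_map ^^ n) (proj x) = proj (shift (- int n) x)"
  by (induction n) (simp_all add: inv_ext_map)

lemma homeomorphism_outer: "homeomorphism outer outer ext_map (inv_into outer ext_map)"
proof -
  have im: "ext_map ` outer = outer"
  proof
    show "ext_map ` outer \<subseteq> outer"
    proof
      fix z assume "z \<in> ext_map ` outer"
      then obtain x where x: "z = ext_map (proj x)" "x \<notin> natext" by auto
      then show "z \<in> outer" by (simp add: ext_map_proj)
    qed
    show "outer \<subseteq> ext_map ` outer"
    proof
      fix z assume "z \<in> outer"
      then obtain x where x: "z = proj x" "x \<notin> natext" by auto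
      then have "z = ext_map (proj (shift (-1) x))" "proj (shift (-1) x) \<in> outer" by (simp_all add: ext_map_proj)
      then show "z \<in> ext_map ` outer" by blast
    qed
  qed
  show ?thesis
    unfolding homeomorphism_def
  proof (intro conjI ballI)
    show "continuous_on outer ext_map"
      using zero_dimensional_system_ext_map
      by (auto simp: zero_dimensional_system_def dynamical_system_def intro: continuous_on_subset)
    show "continuous_on outer (inv_into outer ext_map)"
    \<comment> \<open>The inverse lifts to the backward shift on the whole compact two-sided shift,
      although \<open>outer\<close> need not be compact.\<close>
    proof (rule continuous_on_factor_compact[where \<Phi> = proj and h = "\<lambda>x. proj (shift (-1) x)"])
      show "continuous_on UNIV (\<lambda>x. proj (shift (-1) x))"
        using continuous_on_compose2[OF continuous_on_proj continuous_on_shift] by simp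
    qed (auto simp: inv_ext_map intro: continuous_on_proj compact_UNIV_fun compact_UNIV_bool)
    show "ext_map ` outer = outer" by (rule im)
    show "inv_into outer ext_map ` outer = outer"
      using bij_betw_inv_into[of ext_map outer outer] im inj_on_ext_map by (simp add: bij_betw_def)
    show "inv_into outer ext_map (ext_map x) = x" if "x \<in> outer" for x
      using inv_into_f_f[OF inj_on_ext_map that] .
    show "ext_map (inv_into outer ext_map x) = x" if "x \<in> outer" for x
      using f_inv_into_f[of x ext_map outer] that im by simp
  qed
qed

end

subsection \<open>A Cantor set of recurrent, proximal and transitive points\<close>

text \<open>The radius \<open>q\<close> is below \<open>4 ^ q\<close>, so the blocks are pairwise
  disjoint and stay away from the origin, while their radii grow without bound.\<close>

definition window :: "nat \<Rightarrow> int \<Rightarrow> bool" where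
  "window q i \<longleftrightarrow> \<bar>\<bar>i\<bar> - 4 ^ Suc q\<bar> \<le> int q"

lemma less_power_4: "int q < 4 ^ q"
proof (induction q)
  case (Suc q)
  then show ?case unfolding power_Suc of_nat_Suc by linarith
qed simp

lemma window_unique:
  assumes "window q i" "window r i"
  shows "q = r"
proof -
  have False if "window q i" "window r i" "q < r" for q r
  proof -
    have "(4::int) ^ Suc q \<le> 4 ^ r" using that(3) by (intro power_increasing) auto
    moreover have "int q < 4 ^ q" "int r < 4 ^ r" by (rule less_power_4)+
    ultimately show False using that(1,2) unfolding window_def power_Suc by linarith
  qed
  then show ?thesis using assms by (meson linorder_neqE_nat)
qed

text \<open>The offset from the block centre is at most \<open>q\<close>, hence below
  \<open>4 ^ q\<close>, while the position itself has absolute value above \<open>3 * 4 ^ q\<close>.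
  This makes the recursion of \<open>chaotic_point\<close> terminate.\<close>

lemma window_offset_less:
  assumes "window q i"
  shows "\<bar>i - sgn i * 4 ^ Suc q\<bar> < \<bar>i\<bar>"
proof -
  define P :: int where "P = 4 ^ q"
  have "int q < P" unfolding P_def by (rule less_power_4)
  moreover have "\<bar>\<bar>i\<bar> - 4 * P\<bar> \<le> int q" using assms by (simp add: window_def P_def)
  ultimately have "\<bar>i - sgn i * (4 * P)\<bar> < \<bar>i\<bar>"
    by (cases i "0::int" rule: linorder_cases) auto
  then show ?thesis by (simp add: P_def)
qed

text \<open>The first component of the decoded pair is padding: it lets every finite pattern occur
  for arbitrarily large \<open>m\<close>, hence in arbitrarily wide blocks.\<close>

definition pattern :: "nat \<Rightarrow> int \<Rightarrow> nat \<Rightarrow> bool" where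
  "pattern m i n \<longleftrightarrow> (i, n) \<in> set (snd (from_nat m :: nat \<times> (int \<times> nat) list))"

lemma pattern_dense: "\<exists>m\<ge>k. agree k (pattern m) w"
proof -
  have "finite {(i, n). (\<bar>i\<bar> \<le> int k \<and> n \<le> k) \<and> w i n}"
    by (rule finite_subset[OF _ finite_agree_window[of k]]) auto
  then obtain l where l: "set l = {(i, n). (\<bar>i\<bar> \<le> int k \<and> n \<le> k) \<and> w i n}"
    using finite_list by blast
  have "inj (\<lambda>a :: nat. to_nat (a, l))" by (auto intro: injI)
  then have "infinite (range (\<lambda>a :: nat. to_nat (a, l)))" by (rule range_inj_infinite)
  then obtain m where "m \<ge> k" "m \<in> range (\<lambda>a :: nat. to_nat (a, l))"
    unfolding infinite_nat_iff_unbounded_le by blast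
  moreover from this obtain a :: nat where "m = to_nat (a, l)" by blast
  ultimately show ?thesis by (auto simp: agree_def pattern_def l)
qed

text \<open>The four residues serve proximality, recurrence, transitivity and injectivity in this
  order. A copied centre may itself contain earlier blocks, hence the recursion. In a marker block,
  level 0 locates the centre and level 1 carries a digit of \<open>t\<close>.\<close>

function chaotic_point :: "(nat \<Rightarrow> bool) \<Rightarrow> int \<Rightarrow> nat \<Rightarrow> bool" where
  "chaotic_point t i =
    (if \<exists>q. window q i then
       (let q = (THE q. window q i); j = i - sgn i * 4 ^ Suc q in
        if q mod 4 = 0 then (\<lambda>_. False)
        else if q mod 4 = 1 then chaotic_point t j
        else if q mod 4 = 2 then pattern (q div 4) j
        else (\<lambda>n. j = 0 \<and> (n = 0 \<or> n = 1 \<and> t (q div 4))))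
     else (\<lambda>_. False))"
  by pat_completeness auto
termination
proof (relation "Wellfounded.measure (\<lambda>(t, i). nat \<bar>i\<bar>)", goal_cases)
  case (2 t i q j)
  then have "window q i" using window_unique by (metis theI)
  then show ?case using window_offset_less[of q i] 2(3) by simp
qed simp

declare chaotic_point.simps [simp del]

lemma chaotic_point_window:
  assumes "window q i"
  shows "chaotic_point t i =
    (if q mod 4 = 0 then (\<lambda>_. False)
     else if q mod 4 = 1 then chaotic_point t (i - sgn i * 4 ^ Suc q)
     else if q mod 4 = 2 then pattern (q div 4) (i - sgn i * 4 ^ Suc q)
     else (\<lambda>n. i - sgn i * 4 ^ Suc q = 0 \<and> (n = 0 \<or> n = 1 \<and> t (q div 4))))"
proof -
  have "(THE q. window q i) = q" using assms window_unique by blast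
  moreover have "\<exists>q. window q i" using assms by blast
  ultimately show ?thesis by (subst chaotic_point.simps) (simp add: Let_def)
qed

lemma window_centre:
  assumes "s = 1 \<or> s = -1" "\<bar>j\<bar> \<le> int q"
  shows "window q (j + s * 4 ^ Suc q)" "sgn (j + s * 4 ^ Suc q) = s"
proof -
  define P :: int where "P = 4 ^ Suc q"
  have "\<bar>j\<bar> < P" using assms(2) less_power_4[of q] unfolding P_def power_Suc by linarith
  with assms have "\<bar>\<bar>j + s * P\<bar> - P\<bar> \<le> int q" "sgn (j + s * P) = s"
    by (auto simp: sgn_if)
  then show "window q (j + s * 4 ^ Suc q)" "sgn (j + s * 4 ^ Suc q) = s"
    unfolding window_def P_def .
qed

text \<open>The block on the negative side is a translate of the one on the positive side, not its
  mirror image, so both time directions are handled by the same sign parameter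
  \<open>s\<close>.\<close>

lemma chaotic_point_centre:
  assumes "s = 1 \<or> s = -1" "\<bar>j\<bar> \<le> int q"
  shows "chaotic_point t (j + s * 4 ^ Suc q) =
    (if q mod 4 = 0 then (\<lambda>_. False)
     else if q mod 4 = 1 then chaotic_point t j
     else if q mod 4 = 2 then pattern (q div 4) j
     else (\<lambda>n. j = 0 \<and> (n = 0 \<or> n = 1 \<and> t (q div 4))))"
  using chaotic_point_window[OF window_centre(1)[OF assms]] window_centre(2)[OF assms] by simp

section \<open>Zero runs, returns, patterns and markers\<close>

lemma less_4_power_Suc: "m \<le> q \<Longrightarrow> m < 4 ^ Suc q" for m :: nat
  using less_power_4[of q] by (simp flip: of_nat_less_iff)

lemma chaotic_point_zero_run:
  "\<exists>n>m. \<forall>t s. s = 1 \<or> s = -1 \<longrightarrow> agree k (shift (s * int n) (chaotic_point t)) (\<lambda>_ _. False)"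
\<comment> \<open>The index \<open>4 * (m + k)\<close> has residue 0, its block has radius at least
  \<open>k\<close>, and its centre lies beyond \<open>m\<close>.\<close>
proof (intro exI[of _ "4 ^ Suc (4 * (m + k))"] conjI allI impI)
  fix t and s :: int assume "s = 1 \<or> s = -1"
  then show "agree k (shift (s * int (4 ^ Suc (4 * (m + k)))) (chaotic_point t)) (\<lambda>_ _. False)"
    using chaotic_point_centre[of s _ "4 * (m + k)" t] by (auto simp: agree_def shift_def)
qed (rule less_4_power_Suc, simp)

text \<open>A block of residue 1 repeats the centre. Its position does not depend on
  \<open>t\<close>, which is what makes the recurrence uniform.\<close>

lemma chaotic_point_recurrence:
  "\<exists>n>m. \<forall>t s. s = 1 \<or> s = -1 \<longrightarrow> agree k (shift (s * int n) (chaotic_point t)) (chaotic_point t)"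
proof (intro exI[of _ "4 ^ Suc (4 * (m + k) + 1)"] conjI allI impI)
  fix t and s :: int assume s: "s = 1 \<or> s = -1"
  have "(4 * (m + k) + 1) mod 4 = 1" by presburger
  then show "agree k (shift (s * int (4 ^ Suc (4 * (m + k) + 1))) (chaotic_point t)) (chaotic_point t)"
    using chaotic_point_centre[OF s, of _ "4 * (m + k) + 1" t] by (auto simp: agree_def shift_def)
qed (rule less_4_power_Suc, simp)

lemma chaotic_point_transitive:
  "\<exists>n. \<forall>t s. s = 1 \<or> s = -1 \<longrightarrow> agree k (shift (s * int n) (chaotic_point t)) w"
proof -
  obtain m where m: "m \<ge> k" "agree k (pattern m) w" using pattern_dense by blast
  \<comment> \<open>Block \<open>4 * m + 2\<close> displays pattern \<open>m\<close>, and
    \<open>m \<ge> k\<close> makes it wide enough.\<close>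
  have "(4 * m + 2) mod 4 = 2" "(4 * m + 2) div 4 = m" by presburger+
  then have "agree k (shift (s * int (4 ^ Suc (4 * m + 2))) (chaotic_point t)) (pattern m)"
    if "s = 1 \<or> s = -1" for s t
    using chaotic_point_centre[OF that, of _ "4 * m + 2" t] m(1) by (auto simp: agree_def shift_def)
  then show ?thesis using m(2) agree_trans by blast
qed

lemma chaotic_point_marker:
  assumes "\<bar>j\<bar> \<le> int (4 * p + 3)"
  shows "chaotic_point t (j + 4 ^ Suc (4 * p + 3)) = (\<lambda>n. j = 0 \<and> (n = 0 \<or> n = 1 \<and> t p))"
proof -
  have "(4 * p + 3) mod 4 = 3" "(4 * p + 3) div 4 = p" by presburger+
  then show ?thesis using chaotic_point_centre[of 1 j "4 * p + 3" t] assms by simp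
qed

text \<open>A marker sets a digit of level 0, and all such digits vanish on \<open>natext\<close>;
  this keeps the chaotic points outside it.\<close>

lemma chaotic_point_level_0: "\<exists>i. shift a (chaotic_point t) i 0"
proof -
  have "chaotic_point t (0 + 4 ^ Suc (4 * 0 + 3)) 0" by (subst chaotic_point_marker) simp_all
  then have "shift a (chaotic_point t) (4 ^ Suc (4 * 0 + 3) - a) 0" by (simp add: shift_def)
  then show ?thesis by blast
qed

text \<open>Within a marker block level 0 is set at the centre alone, so two equal shifted points
  cannot be displaced relative to each other. After that, level 1 of the markers reads off the
  parameter.\<close>

lemma shift_chaotic_point_inject:
  assumes "shift a (chaotic_point t) = shift b (chaotic_point s)"
  shows "a = b \<and> t = s"
proof -
  have eq: "chaotic_point t i = chaotic_point s (i + (b - a))" for i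
    using fun_cong[OF assms, of "i - a"] by (simp add: shift_def algebra_simps)
  \<comment> \<open>This index makes the marker block wide enough to contain the centre displaced by
    \<open>b - a\<close>.\<close>
  define p where "p = nat \<bar>b - a\<bar>"
  have "chaotic_point s ((b - a) + 4 ^ Suc (4 * p + 3)) 0 \<longleftrightarrow> b - a = 0"
    by (subst chaotic_point_marker) (auto simp: p_def)
  moreover have "chaotic_point t (0 + 4 ^ Suc (4 * p + 3)) 0"
    by (subst chaotic_point_marker) auto
  ultimately have "a = b" using eq[of "4 ^ Suc (4 * p + 3)"] by (simp add: add.commute)
  moreover have "t p = s p" for p
  proof -
    have "chaotic_point u (0 + 4 ^ Suc (4 * p + 3)) 1 = u p" for u
      by (subst chaotic_point_marker) simp_all
    moreover have "chaotic_point t = chaotic_point s" using eq \<open>a = b\<close> by (simp add: fun_eq_iff)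
    ultimately show ?thesis by metis
  qed
  ultimately show ?thesis by (simp add: fun_eq_iff)
qed

text \<open>Each digit is constant in \<open>t\<close>, equal to a single digit of \<open>t\<close>,
  or copied from a position closer to the origin; induction on the distance to the origin covers the
  last case.\<close>

lemma continuous_on_chaotic_point: "continuous_on UNIV chaotic_point"
proof -
  have "continuous_on UNIV (\<lambda>t. chaotic_point t i n)" for i n
  proof (induction "nat \<bar>i\<bar>" arbitrary: i rule: less_induct)
    case less
    show ?case
    proof (cases "\<exists>q. window q i")
      case True
      then obtain q where q: "window q i" by blast
      define j where "j = i - sgn i * 4 ^ Suc q"
      have "nat \<bar>j\<bar> < nat \<bar>i\<bar>" using window_offset_less[OF q] by (simp add: j_def)
      then have j: "continuous_on UNIV (\<lambda>t. chaotic_point t j n)" by (rule less)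
      consider "q mod 4 = 0" | "q mod 4 = 1" | "q mod 4 = 2" | "q mod 4 = 3" by linarith
      then show ?thesis
      proof cases
        case 2
        then show ?thesis using j by (simp add: chaotic_point_window[OF q] del: power_Suc flip: j_def)
      next
        case 4
        then show ?thesis
          by (cases "j = 0"; cases "n = 0"; cases "n = 1") (simp_all add: chaotic_point_window[OF q] del: power_Suc flip: j_def)
      qed (simp_all add: chaotic_point_window[OF q])
    next
      case False
      then show ?thesis by (simp add: chaotic_point.simps)
    qed
  qed
  then show ?thesis by (intro continuous_on_coordinatewise_then_product)
qed

subsection \<open>The chaotic set\<close>

lemma liminf_eq_0I:
  fixes u :: "nat \<Rightarrow> real"
  assumes "\<And>n. 0 \<le> u n" and small: "\<And>\<epsilon> m. \<epsilon> > 0 \<Longrightarrow> \<exists>n>m. u n \<le> \<epsilon>"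
  shows "liminf (\<lambda>n. ereal (u n)) = 0"
proof (rule antisym)
  show "0 \<le> liminf (\<lambda>n. ereal (u n))"
    using assms(1) by (intro Liminf_bounded) auto
  show "liminf (\<lambda>n. ereal (u n)) \<le> 0"
    unfolding liminf_SUP_INF
  proof (rule SUP_least)
    fix m
    show "(INF n\<in>{m..}. ereal (u n)) \<le> 0"
    proof (rule ereal_le_epsilon2)
      fix \<epsilon> :: real assume "0 < \<epsilon>"
      then obtain n where "n > m" "u n \<le> \<epsilon>" using small by blast
      then have "(INF n\<in>{m..}. ereal (u n)) \<le> ereal (u n)" by (intro INF_lower) simp
      then show "(INF n\<in>{m..}. ereal (u n)) \<le> 0 + ereal \<epsilon>"
        using \<open>u n \<le> \<epsilon>\<close> by (simp add: order_trans)
    qed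
  qed
qed

context coded_system
begin

lemma chaotic_point_notin_natext [simp]: "chaotic_point t \<notin> natext"
  using chaotic_point_level_0[of 0 t] natext_level_0 by auto

text \<open>Uniform estimates survive a bounded range of shifts, while invariance needs all of them;
  hence this exhaustion of the full orbit of the Cantor set.\<close>

definition chaotic_piece :: "nat \<Rightarrow> (nat \<Rightarrow> real) set" where
  "chaotic_piece N = (\<Union>i\<in>{- int N..int N}. range (\<lambda>t. proj (shift i (chaotic_point t))))"

lemma chaotic_piece_I: "\<bar>i\<bar> \<le> int N \<Longrightarrow> proj (shift i (chaotic_point t)) \<in> chaotic_piece N"
  unfolding chaotic_piece_def by (intro UN_I[of i]) auto

lemma chaotic_piece_E:
  assumes "z \<in> chaotic_piece N"
  obtains i t where "z = proj (shift i (chaotic_point t))" "\<bar>i\<bar> \<le> int N"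
  using assms unfolding chaotic_piece_def by force

lemma UN_chaotic_piece: "(\<Union>N. chaotic_piece N) = {proj (shift i (chaotic_point t)) | i t. True}"
proof
  show "(\<Union>N. chaotic_piece N) \<subseteq> {proj (shift i (chaotic_point t)) | i t. True}"
    by (auto elim!: chaotic_piece_E)
  show "{proj (shift i (chaotic_point t)) | i t. True} \<subseteq> (\<Union>N. chaotic_piece N)"
  proof clarify
    fix i t
    have "proj (shift i (chaotic_point t)) \<in> chaotic_piece (nat \<bar>i\<bar>)" by (rule chaotic_piece_I) simp
    then show "proj (shift i (chaotic_point t)) \<in> (\<Union>N. chaotic_piece N)" by blast
  qed
qed

lemma proj_shift_chaotic_point_inject: "proj (shift i (chaotic_point t)) = proj (shift j (chaotic_point s)) \<longleftrightarrow> i = j \<and> t = s"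
  using proj_eq_outside[of "shift i (chaotic_point t)" "shift j (chaotic_point s)"] shift_chaotic_point_inject by auto

lemma incseq_chaotic_piece: "incseq chaotic_piece"
  unfolding chaotic_piece_def by (intro incseq_SucI UN_mono) auto

text \<open>Each shift gives an embedded copy of binary sequence space, and the markers make the
  copies for different shifts disjoint.\<close>

lemma cantor_set_chaotic_piece: "cantor_set (chaotic_piece N)"
  unfolding chaotic_piece_def
proof (rule cantor_set_UN)
  show "cantor_set (range (\<lambda>t. proj (shift i (chaotic_point t))))" for i
  proof (rule cantor_setI)
    have "continuous_on UNIV (\<lambda>t. shift i (chaotic_point t))"
      using continuous_on_compose2[OF continuous_on_shift continuous_on_chaotic_point] by simp
    then show "continuous_on UNIV (\<lambda>t. proj (shift i (chaotic_point t)))"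
      using continuous_on_compose2[OF continuous_on_proj] by simp
    show "inj (\<lambda>t. proj (shift i (chaotic_point t)))"
      by (rule injI) (simp add: proj_shift_chaotic_point_inject)
  qed
  show "disjoint_family_on (\<lambda>i. range (\<lambda>t. proj (shift i (chaotic_point t)))) {- int N..int N}"
    unfolding disjoint_family_on_def by (auto simp: proj_shift_chaotic_point_inject)
qed auto

lemma chaotic_piece_subset_range: "chaotic_piece N \<subseteq> range proj"
  by (auto elim!: chaotic_piece_E)

section \<open>Dynamics of the pieces, for both time directions at once\<close>

context
  fixes h :: "(nat \<Rightarrow> real) \<Rightarrow> nat \<Rightarrow> real" and s :: int
  assumes s: "s = 1 \<or> s = -1"
    and h: "\<And>n i t. (h ^^ n) (proj (shift i (chaotic_point t))) = proj (shift (s * int n + i) (chaotic_point t))"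
begin

text \<open>A return of the unshifted points on a window enlarged by \<open>N\<close> is a return on
  the window \<open>k\<close> for all shifts by at most \<open>N\<close>.\<close>

lemma uniformly_recurrent_chaotic_piece: "uniformly_recurrent h (chaotic_piece N)"
  unfolding uniformly_recurrent_def
proof (intro allI impI)
  fix \<epsilon> :: real and m :: nat assume "\<epsilon> > 0"
  then obtain k where k: "\<And>x z. agree k x z \<Longrightarrow> dist (proj x) (proj z) < \<epsilon>"
    using proj_uniform by metis
  obtain n where n: "n > m" "\<And>t. agree (k + N) (shift (s * int n) (chaotic_point t)) (chaotic_point t)"
    using chaotic_point_recurrence[of m "k + N"] s by blast
  have "dist ((h ^^ n) z) z < \<epsilon>" if zN: "z \<in> chaotic_piece N" for z
  proof -
    obtain i t where z: "z = proj (shift i (chaotic_point t))" and i: "\<bar>i\<bar> \<le> int N" using chaotic_piece_E[OF zN] by blast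
    show ?thesis
      using k[OF agree_shift[OF n(2) i]] by (simp add: z h add.commute)
  qed
  with n(1) show "\<exists>n>m. \<forall>z\<in>chaotic_piece N. dist ((h ^^ n) z) z < \<epsilon>" by blast
qed

text \<open>At a common time all points of the piece have representatives vanishing on the window
  \<open>k\<close>, so their images are pairwise close.\<close>

lemma uniformly_proximal_chaotic_piece: "uniformly_proximal h (chaotic_piece N)"
  unfolding uniformly_proximal_def
proof (rule liminf_eq_0I)
  have "(h ^^ n) ` chaotic_piece N \<subseteq> range proj" for n by (auto elim!: chaotic_piece_E simp: h)
  then have "bounded ((h ^^ n) ` chaotic_piece N)" for n
    using bounded_subset compact_imp_bounded[OF compact_range_proj] by blast
  then show "0 \<le> diameter ((h ^^ n) ` chaotic_piece N)" for n by (rule diameter_ge_0)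
  fix \<epsilon> :: real and m :: nat assume "\<epsilon> > 0"
  then obtain k where k: "\<And>x z. agree k x z \<Longrightarrow> dist (proj x) (proj z) < \<epsilon>"
    using proj_uniform by metis
  obtain n where n: "n > m" "\<And>t. agree (k + N) (shift (s * int n) (chaotic_point t)) (\<lambda>_ _. False)"
    using chaotic_point_zero_run[of m "k + N"] s by blast
  have "dist z w \<le> \<epsilon>" if zw: "z \<in> (h ^^ n) ` chaotic_piece N" "w \<in> (h ^^ n) ` chaotic_piece N" for z w
  proof -
    have 0: "\<exists>x. z = proj x \<and> agree k x (\<lambda>_ _. False)" if zN: "z \<in> (h ^^ n) ` chaotic_piece N" for z
    proof -
      obtain y where y: "y \<in> chaotic_piece N" "z = (h ^^ n) y" using zN by blast
      obtain i t where "y = proj (shift i (chaotic_point t))" and i: "\<bar>i\<bar> \<le> int N"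
        using chaotic_piece_E[OF y(1)] by blast
      with y(2) have "z = proj (shift i (shift (s * int n) (chaotic_point t)))" by (simp add: h add.commute)
      moreover have "agree k (shift i (shift (s * int n) (chaotic_point t))) (\<lambda>_ _. False)"
        using agree_shift[OF n(2) i] by (simp add: shift_def)
      ultimately show ?thesis by blast
    qed
    obtain x y where "z = proj x" "agree k x (\<lambda>_ _. False)" "w = proj y" "agree k y (\<lambda>_ _. False)"
      using 0[OF zw(1)] 0[OF zw(2)] by blast
    moreover from this have "agree k x y" using agree_trans agree_sym by blast
    ultimately show ?thesis using k by force
  qed
  then have "diameter ((h ^^ n) ` chaotic_piece N) \<le> \<epsilon>"
    using \<open>\<epsilon> > 0\<close> by (auto simp: diameter_def intro!: cSUP_least)
  with n(1) show "\<exists>n>m. diameter ((h ^^ n) ` chaotic_piece N) \<le> \<epsilon>" by blast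
qed

lemma dense_orbit: "dense_in (range proj) (range (\<lambda>n. (h ^^ n) (proj (shift i (chaotic_point t)))))"
  unfolding dense_in_def
proof
  show "range (\<lambda>n. (h ^^ n) (proj (shift i (chaotic_point t)))) \<subseteq> range proj" by (auto simp: h)
  show "range proj \<subseteq> closure (range (\<lambda>n. (h ^^ n) (proj (shift i (chaotic_point t)))))"
  proof clarify
    fix w
    show "proj w \<in> closure (range (\<lambda>n. (h ^^ n) (proj (shift i (chaotic_point t)))))"
      unfolding closure_approachable
    proof (intro allI impI)
      fix \<epsilon> :: real assume "\<epsilon> > 0"
      then obtain k where k: "\<And>x z. agree k x z \<Longrightarrow> dist (proj x) (proj z) < \<epsilon>"
        using proj_uniform by metis
      define N where "N = nat \<bar>i\<bar>"
      \<comment> \<open>The target is shifted by \<open>-i\<close> in advance, since the orbit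
        starts at a point shifted by \<open>i\<close>.\<close>
      obtain n where n: "agree (k + N) (shift (s * int n) (chaotic_point t)) (shift (-i) w)"
        using chaotic_point_transitive[of "k + N" "shift (-i) w"] s by blast
      have "\<bar>i\<bar> \<le> int N" by (simp add: N_def)
      then have "agree k (shift i (shift (s * int n) (chaotic_point t))) (shift i (shift (-i) w))"
        by (rule agree_shift[OF n])
      then have "dist ((h ^^ n) (proj (shift i (chaotic_point t)))) (proj w) < \<epsilon>"
        using k by (simp add: h add.commute)
      then show "\<exists>z\<in>range (\<lambda>n. (h ^^ n) (proj (shift i (chaotic_point t)))). dist z (proj w) < \<epsilon>" by blast
    qed
  qed
qed

end

text \<open>The factor 1 is kept so that the equation matches the assumption \<open>h\<close> with
  \<open>s = 1\<close>.\<close>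

lemma ext_map_funpow_chaotic_point:
  "(ext_map ^^ n) (proj (shift i (chaotic_point t))) = proj (shift (1 * int n + i) (chaotic_point t))"
  by (simp add: ext_map_funpow)

lemma inv_ext_map_funpow_chaotic_point:
  "(inv_into outer ext_map ^^ n) (proj (shift i (chaotic_point t))) = proj (shift (- 1 * int n + i) (chaotic_point t))"
  by (simp add: inv_ext_map_funpow)

lemmas forward_dynamics =
  uniformly_recurrent_chaotic_piece[OF disjI1[OF refl] ext_map_funpow_chaotic_point]
  uniformly_proximal_chaotic_piece[OF disjI1[OF refl] ext_map_funpow_chaotic_point]
  dense_orbit[OF disjI1[OF refl] ext_map_funpow_chaotic_point]

lemmas backward_dynamics =
  uniformly_recurrent_chaotic_piece[OF disjI2[OF refl] inv_ext_map_funpow_chaotic_point]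
  uniformly_proximal_chaotic_piece[OF disjI2[OF refl] inv_ext_map_funpow_chaotic_point]
  dense_orbit[OF disjI2[OF refl] inv_ext_map_funpow_chaotic_point]

section \<open>Properties of the union of the pieces\<close>

lemma uniformly_chaotic_set_UN_chaotic_piece: "uniformly_chaotic_set (range proj) ext_map (\<Union>N. chaotic_piece N)"
  unfolding uniformly_chaotic_set_def
  using cantor_set_chaotic_piece chaotic_piece_subset_range incseq_chaotic_piece forward_dynamics(1,2) by blast

lemma UN_chaotic_piece_subset_outer: "(\<Union>N. chaotic_piece N) \<subseteq> outer"
proof
  fix z assume "z \<in> (\<Union>N. chaotic_piece N)"
  then obtain i t where "z = proj (shift i (chaotic_point t))" unfolding UN_chaotic_piece by blast
  then show "z \<in> outer" by simp
qed

lemma ext_map_UN_chaotic_piece: "ext_map ` (\<Union>N. chaotic_piece N) = (\<Union>N. chaotic_piece N)"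
  unfolding UN_chaotic_piece
proof
  show "ext_map ` {proj (shift i (chaotic_point t)) |i t. True} \<subseteq> {proj (shift i (chaotic_point t)) |i t. True}"
    by (force simp: ext_map_proj)
  show "{proj (shift i (chaotic_point t)) |i t. True} \<subseteq> ext_map ` {proj (shift i (chaotic_point t)) |i t. True}"
  proof clarify
    fix i t
    have "proj (shift i (chaotic_point t)) = ext_map (proj (shift (i - 1) (chaotic_point t)))" by (simp add: ext_map_proj)
    then show "proj (shift i (chaotic_point t)) \<in> ext_map ` {proj (shift i (chaotic_point t)) |i t. True}" by blast
  qed
qed

lemma transitive_UN_chaotic_piece:
  assumes "z \<in> (\<Union>N. chaotic_piece N)"
  shows "positively_transitive (range proj) ext_map z" "negatively_transitive outer (range proj) ext_map z"
  using assms forward_dynamics(3) backward_dynamics(3)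
  unfolding UN_chaotic_piece positively_transitive_def negatively_transitive_def by blast+

text \<open>The union contains the whole forward orbit of one chaotic point, which is already
  dense.\<close>

lemma dense_UN_chaotic_piece: "dense_in (range proj) (\<Union>N. chaotic_piece N)"
proof -
  define x where "x = proj (shift 0 (chaotic_point (\<lambda>_. False)))"
  have x: "range proj \<subseteq> closure (range (\<lambda>n. (ext_map ^^ n) x))"
    using forward_dynamics(3) unfolding dense_in_def x_def by blast
  have "range (\<lambda>n. (ext_map ^^ n) x) \<subseteq> (\<Union>N. chaotic_piece N)"
    unfolding UN_chaotic_piece x_def ext_map_funpow_chaotic_point by blast
  then have "range proj \<subseteq> closure (\<Union>N. chaotic_piece N)" using x closure_mono by blast
  then show ?thesis using chaotic_piece_subset_range unfolding dense_in_def by blast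
qed

end

(* The extension X is sought inside the countable product of real lines; every compact metric
   space embeds there, and all notions involved are invariant under homeomorphisms of compact
   metric spaces.  Z is the copy of Y in X. *)
theorem theorem1:
  fixes Y :: "'a::metric_space set" and g :: "'a \<Rightarrow> 'a"
  assumes "zero_dimensional_system Y g" and "chain_transitive Y g"
  shows "\<exists>(X :: (nat \<Rightarrow> real) set) f Z K.
      zero_dimensional_system X f \<and>
      densely_uniformly_chaotic X f \<and>
      subsystem Z X f \<and>
      topologically_conjugate Y g Z f \<and>
      K \<subseteq> X - Z \<and>
      uniformly_chaotic_set X f K \<and>
      homeomorphism (X - Z) (X - Z) f (inv_into (X - Z) f) \<and>
      (\<exists>C :: nat \<Rightarrow> (nat \<Rightarrow> real) set.
         K = (\<Union>N. C N) \<and> incseq C \<and> (\<forall>N. cantor_set (C N)) \<and>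
         (\<forall>N. uniformly_proximal f (C N) \<and> negatively_uniformly_proximal (X - Z) f (C N)) \<and>
         (\<forall>N. uniformly_recurrent f (C N) \<and> negatively_uniformly_recurrent (X - Z) f (C N))) \<and>
      f ` K = K \<and>
      dense_in X K \<and>
      (\<forall>x\<in>K. positively_transitive X f x \<and> negatively_transitive (X - Z) X f x)"
proof -
  have Y: "compact Y" "totally_disconnected Y" "continuous_on Y g" "g ` Y = Y"
    using assms(1) by (auto simp: zero_dimensional_system_def dynamical_system_def)
  obtain e :: "'a \<Rightarrow> nat \<Rightarrow> bool" where e: "continuous_on Y e" "inj_on e Y" "\<And>y. \<not> e y 0"
    using totally_disconnected_embedding[OF Y(1,2)] by metis
  interpret coded_system Y g e
    by unfold_locales (use Y e in auto)
  have C: "\<exists>C. (\<Union>N. chaotic_piece N) = (\<Union>N. C N) \<and> incseq C \<and> (\<forall>N. cantor_set (C N)) \<and>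
      (\<forall>N. uniformly_proximal ext_map (C N) \<and> negatively_uniformly_proximal outer ext_map (C N)) \<and>
      (\<forall>N. uniformly_recurrent ext_map (C N) \<and> negatively_uniformly_recurrent outer ext_map (C N))"
    unfolding negatively_uniformly_proximal_def negatively_uniformly_recurrent_def
    by (intro exI[of _ chaotic_piece] conjI allI refl incseq_chaotic_piece cantor_set_chaotic_piece
        forward_dynamics(1,2) backward_dynamics(1,2))
  have chaotic: "densely_uniformly_chaotic (range proj) ext_map"
    unfolding densely_uniformly_chaotic_def
    using uniformly_chaotic_set_UN_chaotic_piece dense_UN_chaotic_piece by blast
  \<comment> \<open>The witnesses are the quotient of the full shift, the induced map, the image of
    the natural extension, and the union of all pieces.\<close>
  show ?thesis
    by (intro exI[of _ "range proj"] exI[of _ ext_map] exI[of _ "proj ` natext"]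
        exI[of _ "\<Union>N. chaotic_piece N"]
        conjI ballI zero_dimensional_system_ext_map chaotic subsystem_natext topologically_conjugate_natext
        UN_chaotic_piece_subset_outer uniformly_chaotic_set_UN_chaotic_piece homeomorphism_outer
        C ext_map_UN_chaotic_piece dense_UN_chaotic_piece
        transitive_UN_chaotic_piece)
qed

end
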